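(* MEC-Voting and Majority Threshold Adjustment (MTA) using the majority threshold $T_{cs}=\frac{C_{FP}}{C_{FP}+C_{FN}}$ are equivalent. That is, for an ensemble of $m$ models with vote weights $\alpha_1,\dots,\alpha_m$ and a record with misclassification costs $C_{FN}>0$ and $C_{FP}>0$ to which the models assign outcomes $h_1,\dots,h_m\in\{0,1\}$, the two voting rules assign the same final outcome to the record: with $$S_1=\frac{\sum_{i:h_i=1}\alpha_i C_{h_i}}{\sum_{i=1}^m\alpha_i C_{h_i}},\qquad S_2=\frac{\sum_{i:h_i=1}\alpha_i}{\sum_{i=1}^m\alpha_i},$$ where $C_{h_i}=C_{FN}$ if $h_i=1$ and $C_{h_i}=C_{FP}$ if $h_i=0$, one has $S_1>0.5$ if and only if $S_2>T_{cs}$.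
   Context: Binary classification: each record has class $1$ (positive) or $0$ (negative). $C_{FN}$ is the cost of misclassifying a positive record (false negative) and $C_{FP}$ the cost of misclassifying a negative record (false positive); misclassification costs are assumed higher than the costs of correct classification, and the latter are normalised to $0$. Costs may be constant per class or depend on the record. An ensemble consists of $m$ models; model $i$ outputs an outcome $h_i\in\{0,1\}$ for the record and its vote has weight $\alpha_i$. In weighted majority voting, the final outcome is positive if the normalised weighted sum of positive votes is greater than $0.5$, and negative otherwise. MEC-Voting (minimum expected cost voting), for any ensemble: weighted majority voting in which the weight of model $i$'s vote is $\alpha_i C_{h_i}$, the product of $\alpha_i$ and the misclassification cost $C_{h_i}\in\{C_{FN},C_{FP}\}$ associated with the outcome $h_i$. The normalised weighted sum of positive votes is then $S_1$, so the final outcome is positive if $S_1>0.5$ and negative otherwise. Majority Threshold Adjustment (MTA) using $T_{cs}$: weighted majority voting with vote weights $\alpha_i$, in which the threshold $0.5$ is replaced by the cost-sensitive threshold $T_{cs}$. The normalised weighted sum of positive votes is $S_2$, so the final outcome is positive if $S_2>T_{cs}$ and negative otherwise.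
   Formalization: The vote weights are assumed nonnegative; for arbitrary real weights the claim fails, e.g. weights 2 (positive vote) and -1 (negative vote) with C_FN=1, C_FP=10 give S_1=-1/4 but S_2=2>T_cs. *)

theory Defs
  imports Complex_Main
begin

text \<open>
  Models are indexed by \<open>{1..m}\<close>, and class labels and model outcomes are the numbers
  \<open>0\<close> (negative) and \<open>1\<close> (positive). All rules below concern one fixed record, so
  costs that depend on the record are covered.
\<close>

definition positive_share :: "nat \<Rightarrow> (nat \<Rightarrow> real) \<Rightarrow> (nat \<Rightarrow> nat) \<Rightarrow> real" where
  "positive_share m w h = (\<Sum>i\<in>{i\<in>{1..m}. h i = 1}. w i) / (\<Sum>i=1..m. w i)"

definition weighted_vote :: "real \<Rightarrow> nat \<Rightarrow> (nat \<Rightarrow> real) \<Rightarrow> (nat \<Rightarrow> nat) \<Rightarrow> nat" where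
  "weighted_vote T m w h = (if positive_share m w h > T then 1 else 0)"

definition weighted_majority_vote :: "nat \<Rightarrow> (nat \<Rightarrow> real) \<Rightarrow> (nat \<Rightarrow> nat) \<Rightarrow> nat" where
  "weighted_majority_vote = weighted_vote (1 / 2)"

text \<open>
  A wrong positive outcome is a false positive, yet the cost attached to the outcome \<open>1\<close>
  is \<open>C_FN\<close>: it is the cost of misclassifying a record whose true class is that outcome.
\<close>

definition misclass_cost :: "real \<Rightarrow> real \<Rightarrow> nat \<Rightarrow> real" where
  "misclass_cost C_FN C_FP y = (if y = 1 then C_FN else C_FP)"

definition MEC_vote :: "real \<Rightarrow> real \<Rightarrow> nat \<Rightarrow> (nat \<Rightarrow> real) \<Rightarrow> (nat \<Rightarrow> nat) \<Rightarrow> nat" where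
  "MEC_vote C_FN C_FP m \<alpha> h =
     weighted_majority_vote m (\<lambda>i. \<alpha> i * misclass_cost C_FN C_FP (h i)) h"

definition MTA_vote :: "real \<Rightarrow> nat \<Rightarrow> (nat \<Rightarrow> real) \<Rightarrow> (nat \<Rightarrow> nat) \<Rightarrow> nat" where
  "MTA_vote T m \<alpha> h = weighted_vote T m \<alpha> h"

definition T_cs :: "real \<Rightarrow> real \<Rightarrow> real" where
  "T_cs C_FN C_FP = C_FP / (C_FP + C_FN)"

end

theory Submission
  imports Defs
begin

text \<open>
  With \<open>P\<close> and \<open>N\<close> the total weights of the positive and negative votes, both rules return a
  positive outcome exactly when \<open>P C_FN > N C_FP\<close>. If all weights vanish, both shares are
  the junk value \<open>0 / 0 = 0\<close>, which lies below both thresholds.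
\<close>

lemma share_gt_half_iff:
  fixes p n :: real
  assumes "p \<ge> 0" "n \<ge> 0"
  shows "p / (p + n) > 1 / 2 \<longleftrightarrow> p > n"
proof (cases "p + n = 0")
  case True
  with assms show ?thesis by simp
next
  case False
  with assms have "p + n > 0" by linarith
  \<comment> \<open>A positive denominator can be cleared, leaving
    \<open>2 * p > p + n\<close>.\<close>
  then show ?thesis by (simp add: field_simps)
qed

text \<open>For a positive total, \<open>b / (b + a)\<close> is exactly the share at which
  \<open>p * a\<close> and \<open>n * b\<close> balance; equal costs give back the threshold
  1/2.\<close>

lemma share_gt_cost_ratio_iff:
  fixes p n a b :: real
  assumes "p \<ge> 0" "n \<ge> 0" "a > 0" "b > 0"
  shows "p / (p + n) > b / (b + a) \<longleftrightarrow> p * a > n * b"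
proof (cases "p + n = 0")
  case True
  with assms have "p = 0" "n = 0" by linarith+
  with assms show ?thesis by (simp add: not_less)
next
  case False
  with assms have "p + n > 0" "b + a > 0" by linarith+
  then have "p / (p + n) > b / (b + a) \<longleftrightarrow> b * (p + n) < p * (b + a)"
    by (simp add: divide_less_eq less_divide_eq mult.commute)
  \<comment> \<open>After cross-multiplication the term \<open>p * b\<close> stands on both sides
    and cancels.\<close>
  also have "\<dots> \<longleftrightarrow> p * a > n * b"
    by (simp add: algebra_simps)
  finally show ?thesis .
qed

theorem theorem1:
  fixes m :: nat and \<alpha> :: "nat \<Rightarrow> real" and h :: "nat \<Rightarrow> nat" and C_FN C_FP :: real
  assumes "\<And>i. i \<in> {1..m} \<Longrightarrow> \<alpha> i \<ge> 0"
    and "\<And>i. i \<in> {1..m} \<Longrightarrow> h i \<in> {0, 1}"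
    and "C_FN > 0" and "C_FP > 0"
  shows "MEC_vote C_FN C_FP m \<alpha> h = MTA_vote (T_cs C_FN C_FP) m \<alpha> h \<and>
    ((\<Sum>i\<in>{i\<in>{1..m}. h i = 1}. \<alpha> i * misclass_cost C_FN C_FP (h i))
        / (\<Sum>i=1..m. \<alpha> i * misclass_cost C_FN C_FP (h i)) > 1 / 2
     \<longleftrightarrow> (\<Sum>i\<in>{i\<in>{1..m}. h i = 1}. \<alpha> i) / (\<Sum>i=1..m. \<alpha> i) > C_FP / (C_FP + C_FN))"
proof -
  \<comment> \<open>With \<open>h i \<noteq> 1\<close>, \<open>?neg\<close> is the complement of
    \<open>?pos\<close> in the index set and matches the else branch of
    \<open>misclass_cost\<close>.\<close>
  let ?pos = "{i\<in>{1..m}. h i = 1}" and ?neg = "{i\<in>{1..m}. h i \<noteq> 1}"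
  let ?c = "\<lambda>i. misclass_cost C_FN C_FP (h i)"
  define P where "P = (\<Sum>i\<in>?pos. \<alpha> i)"
  define N where "N = (\<Sum>i\<in>?neg. \<alpha> i)"
  have nonneg: "P \<ge> 0" "N \<ge> 0"
    unfolding P_def N_def using assms(1) by (auto intro: sum_nonneg)
  have split: "(\<Sum>i=1..m. f i) = (\<Sum>i\<in>?pos. f i) + (\<Sum>i\<in>?neg. f i)" for f :: "nat \<Rightarrow> real"
    by (subst sum.union_disjoint [symmetric]) (auto intro: sum.cong)
  \<comment> \<open>The cost is constant on each of the two index sets, so it factors out of the
    sum.\<close>
  have pos: "(\<Sum>i\<in>?pos. \<alpha> i * ?c i) = P * C_FN"
    unfolding P_def sum_distrib_right by (rule sum.cong) (auto simp: misclass_cost_def)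
  have neg: "(\<Sum>i\<in>?neg. \<alpha> i * ?c i) = N * C_FP"
    unfolding N_def sum_distrib_right by (rule sum.cong) (auto simp: misclass_cost_def)
  \<comment> \<open>Here the costs sit in the weights: the two totals compared are
    \<open>P * C_FN\<close> and \<open>N * C_FP\<close>.\<close>
  have "(\<Sum>i\<in>?pos. \<alpha> i * ?c i) / (\<Sum>i=1..m. \<alpha> i * ?c i) > 1 / 2 \<longleftrightarrow> P * C_FN > N * C_FP"
    unfolding split [of "\<lambda>i. \<alpha> i * ?c i"] pos neg
    using nonneg assms(3,4) by (intro share_gt_half_iff) auto
  \<comment> \<open>Now the totals are \<open>P\<close> and \<open>N\<close>, and the costs move
    into the threshold, with \<open>a = C_FN\<close> and \<open>b = C_FP\<close>.\<close>
  also have "\<dots> \<longleftrightarrow> (\<Sum>i\<in>?pos. \<alpha> i) / (\<Sum>i=1..m. \<alpha> i) > C_FP / (C_FP + C_FN)"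
    unfolding split [of \<alpha>] P_def [symmetric] N_def [symmetric]
    using share_gt_cost_ratio_iff [OF nonneg assms(3,4)] by simp
  finally have shares:
    "(\<Sum>i\<in>?pos. \<alpha> i * ?c i) / (\<Sum>i=1..m. \<alpha> i * ?c i) > 1 / 2
     \<longleftrightarrow> (\<Sum>i\<in>?pos. \<alpha> i) / (\<Sum>i=1..m. \<alpha> i) > C_FP / (C_FP + C_FN)" .
  then show ?thesis
    unfolding MEC_vote_def MTA_vote_def weighted_majority_vote_def weighted_vote_def
      positive_share_def T_cs_def
    by simp
qed

end
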